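(* Let $A(x)=(x-a_0)\cdots(x-a_p)$ have pairwise distinct roots $a_0,\dots,a_p\in\mathbb{C}$, let $\nu_0,\dots,\nu_p$ be fixed charges placed at $a_0,\dots,a_p$ respectively, and let $B(x)$ be the polynomial determined by $$\frac{B(x)}{A(x)}=\sum_{j=0}^p\frac{\nu_j}{x-a_j}.$$ Let $r(x)$ be a univariate rational function such that $D(x):=A(x)r'(x)$ is a polynomial, and put $q:=\deg D$, $R(X)=R(x_1,\dots,x_n)=\sum_{k=1}^n r(x_k)$ and $\Omega=\{X\in\mathbb{C}^n: R(X)=0\}$. Let $$L(X)=-\sum_{k=1}^n\sum_{j=0}^p\nu_j\log|a_j-x_k|-\sum_{1\le i<k\le n}\log|x_k-x_i|$$ be the logarithmic energy of $n$ unit movable charges at $x_1,\dots,x_n$ together with the fixed charges. Consider the family of parametric Lamé equations $$A(x)y''+(2B(x)-\rho D(x))y'+V(x)y=0 \qquad (\ast)$$ depending on a complex parameter $\rho$. Let $\mathcal A\subset\mathbb{C}^n$ be the arrangement of all hyperplanes $\{x_i=a_j\}$ ($1\le i\le n$, $0\le j\le p$) and $\{x_i=x_\ell\}$ ($i\ne\ell$). Then the following hold. (1) Let $X^\ast=(x_1^\ast,\dots,x_n^\ast)\in\mathbb{C}^n\setminus\mathcal A$. Assume that $X^\ast$ satisfies the constraint $R(X^\ast)=0$ and is a critical point of the energy function $L(X)$ subject to the constraint $R(X)=0$. Then there exist a polynomial $V(x)$ of degree at most $\max\{p-1,q-1\}$ and a constant $\rho^\ast$ such that $y(x)=(x-x_1^\ast)\cdots(x-x_n^\ast)$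 is a solution of $(\ast)$ with $\rho=\rho^\ast$. (2) Let $V(x)$ be a polynomial with $\deg V\le\max\{p-1,q-1\}$, and let $\rho^\ast$ be a constant for which $(\ast)$ with $\rho=\rho^\ast$ possesses a polynomial solution of the form $y(x)=(x-x_1^\ast)\cdots(x-x_n^\ast)$ such that $X^\ast=(x_1^\ast,\dots,x_n^\ast)\in\Omega\setminus\mathcal A$. Then $$\left.\frac{\partial L(X)}{\partial x_k}\right|_{X^\ast}-\rho^\ast\left.\frac{\partial R(X)}{\partial x_k}\right|_{X^\ast}=0,\qquad k=1,\dots,n,$$ where, by definition, $\left.\frac{\partial R(X)}{\partial x_k}\right|_{X^\ast}:=r'(x_k^\ast)$.
   Context: Here $n\ge 1$ is the number of movable charges and $p+1=\deg A$ is the number of fixed charges; if $A=1$ (that is, $p=-1$) there are no fixed charges and $B=0$. A polynomial of degree at most a negative number is the zero polynomial. A critical point of $L$ subject to the constraint $R(X)=0$ means a critical point of the restriction of $L$ to $\Omega\setminus\mathcal A$. The symbol $\partial/\partial x_k$ applied to $L$ denotes the partial derivative with respect to the complex variable $x_k$.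
   Formalization: The identity in (2) is false as printed; it is corrected to ∂L/∂x_k + (ρ*/4) r'(x_k* ) = 0 (∂/∂x_k the Wirtinger derivative). In (1), at points where all r'(x_k* ) = 0, a critical point means that dL vanishes entirely, since (1) fails otherwise. *)

theory Defs
  imports "HOL-Analysis.Analysis" "HOL-Computational_Algebra.Polynomial"
begin

text \<open>
  The \<open>m\<close> fixed charges \<open>\<nu> j\<close> at \<open>a j\<close> are indexed by \<open>j < m\<close>, with \<open>m = 0\<close> allowed.
  The movable charges are the coordinates of a vector in \<open>complex ^ 'n\<close>; the order on \<open>'n\<close>
  only serves to count every pair of movable charges once.  Charges may be complex, so the energy
  is complex-valued; it is real for real charges.
\<close>

definition energy ::
  "nat \<Rightarrow> (nat \<Rightarrow> complex) \<Rightarrow> (nat \<Rightarrow> complex) \<Rightarrow> complex ^ 'n::{finite,linorder} \<Rightarrow> complex" where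
  "energy m a \<nu> X =
     - (\<Sum>k\<in>UNIV. \<Sum>j<m. \<nu> j * of_real (ln (cmod (a j - X $ k))))
     - (\<Sum>(i, k)\<in>{(i, k). i < k}. of_real (ln (cmod (X $ k - X $ i))))"

definition arrangement :: "nat \<Rightarrow> (nat \<Rightarrow> complex) \<Rightarrow> (complex ^ 'n) set" where
  "arrangement m a =
     (\<Union>i. \<Union>j\<in>{..<m}. {X. X $ i = a j}) \<union> (\<Union>i. \<Union>l\<in>-{i}. {X. X $ i = X $ l})"

text \<open>
  The derivative with respect to the complex variable \<open>x\<^sub>k = u + \<i> v\<close> is
  \<open>(\<partial>/\<partial>u - \<i> \<partial>/\<partial>v) / 2\<close>.  It is the complex partial derivative for holomorphic \<open>F\<close>, and
  sends \<open>log \<bar>x\<^sub>k - c\<bar>\<close> to \<open>1 / (2 (x\<^sub>k - c))\<close>.  At a simple zero \<open>x\<^sub>k\<close> of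
  \<open>y = \<Prod>\<^sub>i (x - x\<^sub>i)\<close> one has \<open>y'' / y' = 2 \<Sum>\<^sub>i 1 / (x\<^sub>k - x\<^sub>i)\<close> over \<open>i \<noteq> k\<close>, so
  \<open>A y'' + (2 B - \<rho> D) y' + V y = 0\<close> with \<open>D = A r'\<close> gives
  \<open>- 4 \<partial>L/\<partial>x\<^sub>k = \<rho> r'(x\<^sub>k)\<close>: the parameter \<open>\<rho>\<close> corresponds to the Lagrange
  multiplier \<open>- \<rho> / 4\<close>.
\<close>

definition complex_partial :: "(complex ^ 'n \<Rightarrow> complex) \<Rightarrow> 'n::finite \<Rightarrow> complex ^ 'n \<Rightarrow> complex" where
  "complex_partial F k X =
     (frechet_derivative F (at X) (axis k 1) - \<i> * frechet_derivative F (at X) (axis k \<i>)) / 2"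

text \<open>
  Tangent space of the hypersurface \<open>R = 0\<close>.  At a smooth point it consists of the velocities
  of curves in the hypersurface.  Where \<open>dR = 0\<close> it is the Zariski tangent space of the
  scheme \<open>R = 0\<close>, that is, everything.  Curves would not do there: for \<open>R x = (x - 1)\<^sup>2\<close>
  on \<open>\<complex>\<close> the zero set is a single point, which would be critical for every function.
\<close>

definition tangent_space :: "(complex ^ 'n \<Rightarrow> complex) \<Rightarrow> complex ^ 'n::finite \<Rightarrow> (complex ^ 'n) set" where
  "tangent_space R X =
     (if frechet_derivative R (at X) = (\<lambda>_. 0) then UNIV
      else {v. \<exists>\<gamma> :: real \<Rightarrow> complex ^ 'n. \<gamma> 0 = X \<and> (\<gamma> has_vector_derivative v) (at 0) \<and>
                 (\<forall>\<^sub>F t in nhds 0. R (\<gamma> t) = 0)})"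

definition constrained_critical_point ::
  "(complex ^ 'n \<Rightarrow> complex) \<Rightarrow> (complex ^ 'n \<Rightarrow> complex) \<Rightarrow> complex ^ 'n::finite \<Rightarrow> bool" where
  "constrained_critical_point F R X \<longleftrightarrow>
     R X = 0 \<and> F differentiable (at X) \<and>
     (\<forall>v\<in>tangent_space R X. frechet_derivative F (at X) v = 0)"

text \<open>
  Where \<open>r\<close> is a rational function such that \<open>D = A r'\<close> is a polynomial, the poles of \<open>r\<close>
  are zeros of \<open>A\<close>; hence outside the arrangement \<open>\<Sum>\<^sub>k r(x\<^sub>k)\<close> is never evaluated at a pole.
\<close>

definition lame_solution ::
  "complex poly \<Rightarrow> complex poly \<Rightarrow> complex poly \<Rightarrow> complex poly \<Rightarrow> complex \<Rightarrow> complex poly \<Rightarrow> bool" where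
  "lame_solution A B D V \<rho> y \<longleftrightarrow>
     A * pderiv (pderiv y) + (smult 2 B - smult \<rho> D) * pderiv y + V * y = 0"

text \<open>With an integer bound: only the zero polynomial has degree at most a negative number.\<close>

definition degree_at_most :: "complex poly \<Rightarrow> int \<Rightarrow> bool" where
  "degree_at_most V d \<longleftrightarrow> V = 0 \<or> int (degree V) \<le> d"

end

theory Submission
  imports Defs "HOL-Complex_Analysis.Conformal_Mappings"
begin

text \<open>
  Write \<open>E\<^sub>k = \<Sum>\<^sub>j \<nu>\<^sub>j / (x\<^sub>k - a\<^sub>j) + \<Sum>\<^sub>i 1 / (x\<^sub>k - x\<^sub>i)\<close>, with \<open>i \<noteq> k\<close>, for the
  field that all other charges produce at \<open>x\<^sub>k\<close>.  Both parts of the theorem compare two readings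
  of the single system
  \<open>2 E\<^sub>k = \<rho> r'(x\<^sub>k)\<close> for all \<open>k\<close>.

  The algebraic reading goes back to Stieltjes.  At a simple zero \<open>x\<^sub>k\<close> of
  \<open>y = \<Prod>\<^sub>i (x - x\<^sub>i)\<close> one has \<open>y'' = 2 y' \<Sum>\<^sub>i 1 / (x\<^sub>k - x\<^sub>i)\<close>.  Hence
  \<open>N = A y'' + (2 B - \<rho> D) y'\<close> takes the value \<open>A y' (2 E\<^sub>k - \<rho> r')\<close> there
  (\<open>lame_residual_at_charge\<close>), and \<open>A y' \<noteq> 0\<close> off the arrangement.  The system therefore says
  that \<open>N\<close> vanishes at every zero of \<open>y\<close>, which for simple zeros means that \<open>y\<close> divides
  \<open>N\<close>; the quotient is \<open>- V\<close>, and its degree is found by counting.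

  The analytic reading is that of Lagrange.  The complex-linear part of \<open>dL\<close> is
  \<open>- (\<Sum>\<^sub>k E\<^sub>k dx\<^sub>k) / 2\<close> (\<open>energy_derivative_complex_linear_part\<close>), which already
  gives part (2).  For part (1) one uses that \<open>dR = \<Sum>\<^sub>k r'(x\<^sub>k) dx\<^sub>k\<close> is complex-linear: its
  kernel is stable under multiplication by \<open>\<i>\<close>, so if \<open>dL\<close> vanishes on this kernel, then so
  does its complex-linear part alone, even though \<open>L\<close> is only real differentiable and, for complex
  charges, not real.  A linear form that vanishes on the kernel of another is a multiple of it
  (\<open>lagrange_multiplier\<close>).  That the kernel of \<open>dR\<close> is tangent to \<open>R = 0\<close> at smooth points
  comes from the local inverse of \<open>r\<close> in one coordinate (\<open>zero_curve_with_velocity\<close>).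

  For all this \<open>r\<close> must be holomorphic at the charges.  This holds because a pole of \<open>r\<close>
  is a pole of \<open>r'\<close> of higher order, which only a zero of \<open>A\<close> can compensate
  (\<open>poles_subset_zeros_of_multiplier\<close>).
\<close>

section \<open>The gradient of the energy\<close>

lemma not_in_arrangement_iff:
  "X \<notin> arrangement m a \<longleftrightarrow>
     (\<forall>k. \<forall>j<m. X $ k \<noteq> a j) \<and> (\<forall>k. \<forall>i\<in>-{k}. X $ k \<noteq> X $ i)"
  by (simp add: arrangement_def Ball_def)

text \<open>
  The energy counts each pair of movable charges once, while the field at a charge collects all
  the others: splitting each unordered pair into its two ordered ones passes from the first to the
  second.
\<close>

lemma sum_symmetric_over_pairs:
  fixes h :: "'n::{finite,linorder} \<Rightarrow> 'n \<Rightarrow> 'b::comm_monoid_add"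
  shows "(\<Sum>(i, k)\<in>{(i, k). i < k}. h k i + h i k) = (\<Sum>k\<in>UNIV. \<Sum>i\<in>-{k}. h k i)"
proof -
  let ?S = "{(i::'n, k). i < k}" and ?T = "{(i::'n, k). k < i}"
  have "(\<Sum>(i, k)\<in>?S. h k i + h i k) = (\<Sum>(i, k)\<in>?S. h k i) + (\<Sum>(i, k)\<in>?S. h i k)"
    by (simp add: case_prod_beta sum.distrib)
  also have "(\<Sum>(i, k)\<in>?S. h i k) = (\<Sum>(i, k)\<in>?T. h k i)"
    by (rule sum.reindex_bij_witness[of _ prod.swap prod.swap]) auto
  also have "(\<Sum>(i, k)\<in>?S. h k i) + (\<Sum>(i, k)\<in>?T. h k i) = (\<Sum>(i, k)\<in>?S \<union> ?T. h k i)"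
    by (rule sum.union_disjoint[symmetric]) auto
  also have "\<dots> = (\<Sum>(k, i)\<in>(SIGMA k:UNIV. -{k}). h k i)"
    by (rule sum.reindex_bij_witness[of _ prod.swap prod.swap]) auto
  also have "\<dots> = (\<Sum>k\<in>UNIV. \<Sum>i\<in>-{k}. h k i)"
    by (simp add: sum.Sigma)
  finally show ?thesis .
qed

text \<open>
  Locally \<open>ln \<bar>z\<bar>\<close> is the real part of a branch of the logarithm, whose differential is
  \<open>dz / z\<close>.  Differentiating the norm directly avoids the choice of a branch.
\<close>

lemma has_derivative_ln_cmod:
  fixes f :: "'a::real_normed_vector \<Rightarrow> complex"
  assumes "(f has_derivative f') (at x)" and "f x \<noteq> 0"
  shows "((\<lambda>x. of_real (ln (cmod (f x))) :: complex) has_derivative (\<lambda>v. of_real (Re (f' v / f x)))) (at x)"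
proof -
  have "(cmod has_derivative (\<lambda>w. sgn (f x) \<bullet> w)) (at (f x))"
    using has_derivative_norm[OF assms(2)] by (subst inner_commute)
  from has_derivative_compose[OF assms(1) this]
  have "((\<lambda>x. ln (cmod (f x))) has_derivative (\<lambda>v. (sgn (f x) \<bullet> f' v) * inverse (cmod (f x)))) (at x)"
    using has_derivative_ln[of "\<lambda>x. cmod (f x)" x] assms(2) by simp
  moreover have "(sgn (f x) \<bullet> w) * inverse (cmod (f x)) = Re (w / f x)" for w
    unfolding Re_divide cmod_power2[symmetric]
    by (simp add: inner_complex_def sgn_div_norm power2_eq_square divide_inverse algebra_simps)
  ultimately show ?thesis
    by (auto intro: has_derivative_of_real)
qed

text \<open>
  The holomorphic field at the \<open>k\<close>-th movable charge, without the factor \<open>- 1/2\<close> that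
  relates it to the derivative of the energy.
\<close>

definition charge_field ::
  "nat \<Rightarrow> (nat \<Rightarrow> complex) \<Rightarrow> (nat \<Rightarrow> complex) \<Rightarrow> complex ^ 'n::finite \<Rightarrow> 'n \<Rightarrow> complex" where
  "charge_field m a \<nu> X k = (\<Sum>j<m. \<nu> j / (X $ k - a j)) + (\<Sum>i\<in>-{k}. 1 / (X $ k - X $ i))"

lemma has_derivative_energy:
  fixes X :: "complex ^ 'n::{finite,linorder}"
  assumes "X \<notin> arrangement m a"
  shows "(energy m a \<nu> has_derivative
     (\<lambda>v. - (\<Sum>k\<in>UNIV. (\<Sum>j<m. \<nu> j * of_real (Re (v $ k / (X $ k - a j))))
                     + (\<Sum>i\<in>-{k}. of_real (Re (v $ k / (X $ k - X $ i))))))) (at X)"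
proof -
  have nea: "a j - X $ k \<noteq> 0" if "j < m" for j k
    using assms that by (metis not_in_arrangement_iff right_minus_eq)
  have nex: "X $ k - X $ i \<noteq> 0" if "i \<noteq> k" for i k
    using assms that by (simp add: not_in_arrangement_iff)
  have d: "((\<lambda>X. X $ k) has_derivative (\<lambda>v. v $ k)) (at X)" for k :: 'n
    by (rule bounded_linear_imp_has_derivative) (rule bounded_linear_vec_nth)
  have fixed: "((\<lambda>X. \<nu> j * of_real (ln (cmod (a j - X $ k)))) has_derivative
         (\<lambda>v. \<nu> j * of_real (Re (v $ k / (X $ k - a j))))) (at X)" if "j < m" for j k
  proof -
    have "((\<lambda>X. a j - X $ k) has_derivative (\<lambda>v. 0 - v $ k)) (at X)"
      by (intro has_derivative_diff has_derivative_const d)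
    from has_derivative_ln_cmod[OF this nea[OF that]]
    have "((\<lambda>X. complex_of_real (ln (cmod (a j - X $ k)))) has_derivative
         (\<lambda>v. of_real (Re ((0 - v $ k) / (a j - X $ k))))) (at X)" .
    moreover have "(0 - w) / (a j - X $ k) = w / (X $ k - a j)" for w
      using minus_divide_divide[of w "X $ k - a j"] by simp
    ultimately show ?thesis
      by (metis (no_types, lifting) has_derivative_mult_right ext)
  qed
  have pair: "((\<lambda>X. complex_of_real (ln (cmod (X $ k - X $ i)))) has_derivative
         (\<lambda>v. of_real (Re (v $ k / (X $ k - X $ i))) + of_real (Re (v $ i / (X $ i - X $ k))))) (at X)"
    if "i < k" for i k
  proof -
    have "((\<lambda>X. X $ k - X $ i) has_derivative (\<lambda>v. v $ k - v $ i)) (at X)"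
      by (intro has_derivative_diff d)
    from has_derivative_ln_cmod[OF this nex] that
    have "((\<lambda>X. complex_of_real (ln (cmod (X $ k - X $ i)))) has_derivative
         (\<lambda>v. of_real (Re ((v $ k - v $ i) / (X $ k - X $ i))))) (at X)" by auto
    moreover have "(u - w) / (X $ k - X $ i) = u / (X $ k - X $ i) + w / (X $ i - X $ k)" for u w
      by (metis add_uminus_conv_diff diff_divide_distrib divide_minus_right minus_diff_eq)
    ultimately show ?thesis by simp
  qed
  have "(energy m a \<nu> has_derivative
     (\<lambda>v. - (\<Sum>k\<in>UNIV. \<Sum>j<m. \<nu> j * of_real (Re (v $ k / (X $ k - a j))))
          - (\<Sum>(i, k)\<in>{(i, k). i < k}. of_real (Re (v $ k / (X $ k - X $ i)))
                + of_real (Re (v $ i / (X $ i - X $ k)))))) (at X)"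
    unfolding energy_def[abs_def]
    by (intro has_derivative_diff has_derivative_minus has_derivative_sum)
       (auto intro: fixed pair simp: case_prod_beta)
  moreover have "(\<Sum>(i, k)\<in>{(i, k). i < k}. complex_of_real (Re (v $ k / (X $ k - X $ i)))
                + of_real (Re (v $ i / (X $ i - X $ k))))
      = (\<Sum>k\<in>UNIV. \<Sum>i\<in>-{k}. of_real (Re (v $ k / (X $ k - X $ i))))" for v :: "complex ^ ('n::{finite,linorder})"
    by (rule sum_symmetric_over_pairs)
  ultimately show ?thesis
    by (simp only: sum.distrib minus_add_distrib diff_conv_add_uminus)
qed

text \<open>
  The combination \<open>f v - \<i> f (\<i> v)\<close> is twice the complex-linear part of a real-linear
  \<open>f\<close>.  It turns \<open>Re (v / z)\<close> into \<open>v / z\<close>, so it removes the real parts from the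
  differential of the energy.
\<close>

lemma energy_derivative_complex_linear_part:
  fixes X :: "complex ^ 'n::{finite,linorder}" and \<nu> :: "nat \<Rightarrow> complex"
  assumes "X \<notin> arrangement m a"
  defines "dL \<equiv> frechet_derivative (energy m a \<nu>) (at X)"
  shows "dL v - \<i> * dL (\<i> *s v) = - (\<Sum>k\<in>UNIV. charge_field m a \<nu> X k * v $ k)"
proof -
  have dL: "dL = (\<lambda>v. - (\<Sum>k\<in>UNIV. (\<Sum>j<m. \<nu> j * of_real (Re (v $ k / (X $ k - a j))))
                     + (\<Sum>i\<in>-{k}. of_real (Re (v $ k / (X $ k - X $ i))))))"
    unfolding dL_def
    using frechet_derivative_at[OF has_derivative_energy[OF assms(1), of \<nu>]] by simp
  \<comment> \<open>The imaginary part of \<open>c / z\<close> appears as \<open>- Re (\<i> c / z)\<close>.\<close>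
  have w: "complex_of_real (Re (c / z)) - \<i> * of_real (Re (\<i> * c / z)) = c / z" for c z
    using complex_eq[of "c / z"] by (simp flip: times_divide_eq_right)
  have "dL v - \<i> * dL (\<i> *s v) =
      - (\<Sum>k\<in>UNIV. (\<Sum>j<m. \<nu> j * (of_real (Re (v $ k / (X $ k - a j)))
                              - \<i> * of_real (Re (\<i> * v $ k / (X $ k - a j)))))
           + (\<Sum>i\<in>-{k}. of_real (Re (v $ k / (X $ k - X $ i)))
                    - \<i> * of_real (Re (\<i> * v $ k / (X $ k - X $ i)))))"
    unfolding dL
    by (simp add: sum_distrib_left sum_subtractf sum.distrib right_diff_distrib
         distrib_left mult.left_commute del: times_divide_eq_right Re_divide)
  then show ?thesis
    unfolding w by (simp add: charge_field_def sum_distrib_right distrib_right)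
qed

lemma complex_partial_energy:
  fixes X :: "complex ^ 'n::{finite,linorder}"
  assumes "X \<notin> arrangement m a"
  shows "complex_partial (energy m a \<nu>) k X = - charge_field m a \<nu> X k / 2"
proof -
  have "\<i> *s axis k 1 = (axis k \<i> :: complex ^ ('n::{finite,linorder}))"
    by (simp add: vec_eq_iff axis_def)
  moreover have "(\<Sum>i\<in>UNIV. charge_field m a \<nu> X i * axis k 1 $ i) = charge_field m a \<nu> X k"
    by (simp add: axis_def if_distrib cong: if_cong)
  ultimately show ?thesis
    using energy_derivative_complex_linear_part[OF assms, of \<nu> "axis k 1"]
    by (simp add: complex_partial_def)
qed

section \<open>The multiplier rule for a separable holomorphic constraint\<close>

text \<open>
  The implicit function theorem for a sum of functions of one variable.  All coordinates but
  the \<open>l\<close>-th move linearly with velocity \<open>v\<close>; the \<open>l\<close>-th is then forced, through the local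
  inverse of \<open>r\<close> at \<open>x\<^sub>l\<close>, and the condition \<open>dR v = 0\<close> says that its velocity is
  \<open>v\<^sub>l\<close> as well.
\<close>

lemma zero_curve_with_velocity:
  fixes X v :: "complex ^ 'n::finite"
  assumes S: "open S" "r holomorphic_on S" "\<And>k. X $ k \<in> S"
    and zero: "(\<Sum>k\<in>UNIV. r (X $ k)) = 0"
    and v: "(\<Sum>k\<in>UNIV. deriv r (X $ k) * v $ k) = 0"
    and nz: "deriv r (X $ l) \<noteq> 0"
  obtains \<gamma> :: "real \<Rightarrow> complex ^ 'n" where "\<gamma> 0 = X" "(\<gamma> has_vector_derivative v) (at 0)"
    "\<forall>\<^sub>F t in nhds 0. (\<Sum>k\<in>UNIV. r (\<gamma> t $ k)) = 0"
proof -
  obtain e where e: "e > 0" "ball (X $ l) e \<subseteq> S" "open (r ` ball (X $ l) e)" "inj_on r (ball (X $ l) e)"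
    using has_complex_derivative_locally_invertible[OF S(2) S(3)[of l] S(1) nz] by metis
  let ?U = "ball (X $ l) e"
  have hol: "r holomorphic_on ?U"
    using S(2) e(2) holomorphic_on_subset by blast
  obtain s where s: "s holomorphic_on r ` ?U"
      "\<And>z. z \<in> ?U \<Longrightarrow> deriv r z * deriv s (r z) = 1" "\<And>z. z \<in> ?U \<Longrightarrow> s (r z) = z"
    using holomorphic_has_inverse[OF hol open_ball e(4)] by metis
  have Xl: "X $ l \<in> ?U" using e(1) by simp
  \<comment> \<open>The value that \<open>r\<close> has to take at the \<open>l\<close>-th coordinate at time \<open>t\<close>.\<close>
  define h where "h t = - (\<Sum>k\<in>-{l}. r (X $ k + of_real t * v $ k))" for t :: real
  define \<gamma> where "\<gamma> t = (\<chi> k. if k = l then s (h t) else X $ k + of_real t * v $ k)" for t :: real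
  have split: "(\<Sum>k\<in>UNIV. f k) = f l + (\<Sum>k\<in>-{l}. f k)" for f :: "'n \<Rightarrow> complex"
    by (simp add: sum.remove[of UNIV l] Compl_eq_Diff_UNIV)
  have h0: "h 0 = r (X $ l)"
    using zero by (simp add: h_def split[of "\<lambda>k. r (X $ k)"] add_eq_0_iff2)
  have lin: "((\<lambda>t. X $ k + of_real t * v $ k) has_vector_derivative v $ k) (at 0)" for k
    by (auto intro!: derivative_eq_intros)
  have "((\<lambda>t. r (X $ k + of_real t * v $ k)) has_vector_derivative v $ k * deriv r (X $ k)) (at 0)" for k
    using field_vector_diff_chain_at[OF lin[of k], of r "deriv r (X $ k)"]
      holomorphic_derivI[OF S(2) S(1) S(3)[of k]] by (simp add: o_def)
  then have "(h has_vector_derivative - (\<Sum>k\<in>-{l}. v $ k * deriv r (X $ k))) (at 0)"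
    unfolding h_def[abs_def]
    by (intro has_vector_derivative_minus has_vector_derivative_sum) auto
  moreover have "- (\<Sum>k\<in>-{l}. v $ k * deriv r (X $ k)) = v $ l * deriv r (X $ l)"
    using v unfolding split[of "\<lambda>k. deriv r (X $ k) * v $ k"] by (metis (no_types, lifting) minus_unique minus_minus mult.commute sum.cong)
  ultimately have dh: "(h has_vector_derivative v $ l * deriv r (X $ l)) (at 0)" by simp
  have "(s has_field_derivative deriv s (h 0)) (at (h 0))"
    using holomorphic_derivI[OF s(1) e(3)] Xl by (simp add: h0)
  from field_vector_diff_chain_at[OF dh this]
  have ds: "((\<lambda>t. s (h t)) has_vector_derivative v $ l) (at 0)"
    using s(2)[OF Xl] by (simp add: o_def h0 mult.assoc)
  have "((\<lambda>t. \<gamma> t $ k) has_vector_derivative v $ k) (at 0)" for k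
    using ds lin[of k] by (cases "k = l") (simp_all add: \<gamma>_def)
  then have "((\<lambda>t. \<gamma> t $ k \<bullet> b) has_derivative (\<lambda>x. (x *\<^sub>R v) $ k \<bullet> b)) (at 0)" for k and b :: complex
    unfolding has_vector_derivative_def vector_scaleR_component by (rule has_derivative_inner_left)
  then have d\<gamma>: "(\<gamma> has_vector_derivative v) (at 0)"
    unfolding has_vector_derivative_def
    by (subst has_derivative_componentwise_within) (auto simp only: Basis_vec_def inner_axis)
  have "(h \<longlongrightarrow> h 0) (nhds 0)"
    using has_vector_derivative_continuous[OF dh] isCont_def tendsto_at_iff_tendsto_nhds by blast
  moreover have "h 0 \<in> r ` ?U"
    using Xl by (simp add: h0)
  ultimately have "\<forall>\<^sub>F t in nhds 0. h t \<in> r ` ?U"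
    using e(3) topological_tendstoD by blast
  then have "\<forall>\<^sub>F t in nhds 0. (\<Sum>k\<in>UNIV. r (\<gamma> t $ k)) = 0"
  proof eventually_elim
    case (elim t)
    then have "r (s (h t)) = h t" using s(3) by auto
    moreover have "(\<Sum>k\<in>-{l}. r (\<gamma> t $ k)) = - h t"
      unfolding h_def by (auto simp: \<gamma>_def intro: sum.cong)
    ultimately show ?case unfolding split[of "\<lambda>k. r (\<gamma> t $ k)"] by (simp add: \<gamma>_def)
  qed
  moreover have "\<gamma> 0 = X"
    using s(3)[OF Xl] by (simp add: vec_eq_iff \<gamma>_def h0)
  ultimately show thesis using that d\<gamma> by blast
qed

text \<open>
  If \<open>\<beta> l \<noteq> 0\<close>, the vectors \<open>\<beta> l e\<^sub>k - \<beta> k e\<^sub>l\<close> lie in the kernel of \<open>\<beta>\<close>, and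
  evaluating \<open>\<alpha>\<close> on them gives \<open>\<alpha> k = (\<alpha> l / \<beta> l) \<beta> k\<close>.
\<close>

lemma kernel_le_imp_multiple:
  fixes \<alpha> \<beta> :: "'n::finite \<Rightarrow> 'f::field"
  assumes "\<And>v :: 'f ^ 'n. (\<Sum>k\<in>UNIV. \<beta> k * v $ k) = 0 \<Longrightarrow> (\<Sum>k\<in>UNIV. \<alpha> k * v $ k) = 0"
  obtains c where "\<And>k. \<alpha> k = c * \<beta> k"
proof (cases "\<forall>k. \<beta> k = 0")
  case True
  have "\<alpha> k = 0" for k
    using assms[of "axis k 1"] True by (simp add: axis_def if_distrib cong: if_cong)
  with True that[of 0] show thesis by simp
next
  case False
  then obtain l where l: "\<beta> l \<noteq> 0" by blast
  have *: "(\<Sum>i\<in>UNIV. f i * (axis k x - axis l y) $ i) = f k * x - f l * y"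
    for f :: "'n \<Rightarrow> 'f" and k x y
  proof -
    have "(\<Sum>i\<in>UNIV. f i * axis j z $ i) = f j * z" for j z
      by (simp add: axis_def if_distrib cong: if_cong)
    then show ?thesis by (simp add: right_diff_distrib sum_subtractf)
  qed
  have "\<alpha> k = \<alpha> l / \<beta> l * \<beta> k" for k
    using assms[of "axis k (\<beta> l) - axis l (\<beta> k)"] l unfolding * by (simp add: field_simps)
  with that show thesis by blast
qed

text \<open>
  The Lagrange multiplier exists also where \<open>dR = 0\<close>: the tangent space is then everything, as
  is the kernel of \<open>dR\<close>.  In both cases it suffices that this kernel consists of tangent vectors.
\<close>

lemma lagrange_multiplier:
  fixes X :: "complex ^ 'n::{finite,linorder}"
  assumes S: "open S" "r holomorphic_on S" "\<And>k. X $ k \<in> S"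
    and X: "X \<notin> arrangement m a"
    and crit: "constrained_critical_point (energy m a \<nu>) (\<lambda>X. \<Sum>k\<in>UNIV. r (X $ k)) X"
  obtains c where "\<And>k. charge_field m a \<nu> X k = c * deriv r (X $ k)"
proof (rule kernel_le_imp_multiple)
  fix v :: "complex ^ ('n::{finite,linorder})"
  let ?R = "\<lambda>X :: complex ^ ('n::{finite,linorder}). \<Sum>k\<in>UNIV. r (X $ k)"
  let ?K = "{v :: complex ^ ('n::{finite,linorder}). (\<Sum>k\<in>UNIV. deriv r (X $ k) * v $ k) = 0}"
  assume "(\<Sum>k\<in>UNIV. deriv r (X $ k) * v $ k) = 0"
  then have v: "v \<in> ?K" by simp
  moreover have "(\<Sum>k\<in>UNIV. deriv r (X $ k) * (\<i> *s v) $ k) = \<i> * (\<Sum>k\<in>UNIV. deriv r (X $ k) * v $ k)"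
    by (simp add: sum_distrib_left mult.left_commute)
  ultimately have iv: "\<i> *s v \<in> ?K" by simp
  have "((\<lambda>X :: complex ^ ('n::{finite,linorder}). r (X $ k)) has_derivative (\<lambda>v. deriv r (X $ k) * v $ k)) (at X)" for k
    using has_derivative_compose[OF bounded_linear_imp_has_derivative[OF bounded_linear_vec_nth]
        holomorphic_derivI[OF S(2) S(1) S(3)[of k], unfolded has_field_derivative_def]] by simp
  then have "(?R has_derivative (\<lambda>v. \<Sum>k\<in>UNIV. deriv r (X $ k) * v $ k)) (at X)"
    by (intro has_derivative_sum) auto
  then have dR: "frechet_derivative ?R (at X) = (\<lambda>v. \<Sum>k\<in>UNIV. deriv r (X $ k) * v $ k)"
    by (rule frechet_derivative_at[symmetric])
  have "?K \<subseteq> tangent_space ?R X"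
  proof (cases "frechet_derivative ?R (at X) = (\<lambda>_. 0)")
    case True
    then show ?thesis by (simp add: tangent_space_def)
  next
    case False
    have "\<exists>l. deriv r (X $ l) \<noteq> 0"
    proof (rule ccontr)
      assume "\<nexists>l. deriv r (X $ l) \<noteq> 0"
      with False show False by (simp add: dR)
    qed
    then obtain l where l: "deriv r (X $ l) \<noteq> 0" ..
    have zero: "?R X = 0" using crit by (simp add: constrained_critical_point_def)
    show ?thesis
    proof
      fix w assume "w \<in> ?K"
      then obtain \<gamma> :: "real \<Rightarrow> complex ^ ('n::{finite,linorder})" where "\<gamma> 0 = X" "(\<gamma> has_vector_derivative w) (at 0)"
         "\<forall>\<^sub>F t in nhds 0. ?R (\<gamma> t) = 0"
        using zero_curve_with_velocity[OF S zero _ l, of w] by auto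
      then show "w \<in> tangent_space ?R X"
        using False by (auto simp: tangent_space_def)
    qed
  qed
  then have "frechet_derivative (energy m a \<nu>) (at X) w = 0" if "w \<in> ?K" for w
    using crit that unfolding constrained_critical_point_def by blast
  from this[OF v] this[OF iv]
  have "frechet_derivative (energy m a \<nu>) (at X) v = 0"
      "frechet_derivative (energy m a \<nu>) (at X) (\<i> *s v) = 0" .
  with energy_derivative_complex_linear_part[OF X, of \<nu> v]
  show "(\<Sum>k\<in>UNIV. charge_field m a \<nu> X k * v $ k) = 0" by simp
qed (use that in blast)

section \<open>Polynomials with prescribed simple zeros\<close>

lemma poly_eq_off_zeros:
  fixes f g h :: "'a::{idom,ring_char_0} poly"
  assumes "h \<noteq> 0" and "\<And>x. poly h x \<noteq> 0 \<Longrightarrow> poly f x = poly g x"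
  shows "f = g"
proof -
  have "poly (h * (f - g)) x = 0" for x
    using assms(2)[of x] by auto
  then have "h * (f - g) = 0" using poly_all_0_iff_0 by blast
  with assms(1) show ?thesis by simp
qed

lemma prod_linear_dvd:
  fixes f :: "'a::idom poly"
  assumes "finite I" and "inj_on x I" and "\<And>i. i \<in> I \<Longrightarrow> poly f (x i) = 0"
  shows "(\<Prod>i\<in>I. [:- x i, 1:]) dvd f"
  using assms
proof (induction I)
  case (insert k I)
  then obtain g where g: "f = (\<Prod>i\<in>I. [:- x i, 1:]) * g"
    by (auto elim!: dvdE)
  have "poly (\<Prod>i\<in>I. [:- x i, 1:]) (x k) \<noteq> 0"
    using insert.hyps insert.prems(1) by (force simp: poly_prod)
  moreover have "poly f (x k) = 0"
    using insert.prems(2) by simp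
  ultimately have "poly g (x k) = 0"
    by (simp add: g)
  then have "[:- x k, 1:] dvd g"
    by (simp add: poly_eq_0_iff_dvd)
  then show ?case
    unfolding g using insert.hyps
    by (simp add: mult.commute mult_dvd_mono del: mult_pCons_left mult_pCons_right)
qed simp

text \<open>
  With \<open>y = (x - x\<^sub>k) u\<close> one has \<open>y'(x\<^sub>k) = u(x\<^sub>k)\<close> and \<open>y''(x\<^sub>k) = 2 u'(x\<^sub>k)\<close>, and
  \<open>u' / u\<close> is the sum of \<open>1 / (x - x\<^sub>i)\<close> over the remaining zeros.
\<close>

lemma pderiv_prod_linear_at_root:
  fixes x :: "'i \<Rightarrow> 'a::field"
  assumes "finite I" and "k \<in> I" and "\<And>i. i \<in> I - {k} \<Longrightarrow> x i \<noteq> x k"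
  defines "y \<equiv> \<Prod>i\<in>I. [:- x i, 1:]"
  shows "poly (pderiv y) (x k) \<noteq> 0"
    and "poly (pderiv (pderiv y)) (x k) = 2 * poly (pderiv y) (x k) * (\<Sum>i\<in>I - {k}. 1 / (x k - x i))"
proof -
  define u where "u = (\<Prod>i\<in>I - {k}. [:- x i, 1:])"
  have y: "y = [:- x k, 1:] * u"
    unfolding y_def u_def using assms(1,2) by (rule prod.remove)
  have u: "poly u (x k) = (\<Prod>i\<in>I - {k}. x k - x i)"
    by (simp add: u_def poly_prod)
  have y': "poly (pderiv y) (x k) = poly u (x k)"
    by (simp add: y pderiv_mult pderiv_pCons del: mult_pCons_left)
  have "poly (pderiv (pderiv y)) (x k) = 2 * poly (pderiv u) (x k)"
    by (simp add: y pderiv_mult pderiv_add pderiv_pCons del: mult_pCons_left)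
  moreover have "poly (pderiv u) (x k) = (\<Sum>j\<in>I - {k}. \<Prod>i\<in>I - {k} - {j}. x k - x i)"
    by (simp add: u_def pderiv_prod poly_sum poly_prod pderiv_pCons)
  moreover have "(\<Prod>i\<in>I - {k} - {j}. x k - x i) = poly u (x k) * (1 / (x k - x j))"
    if "j \<in> I - {k}" for j
  proof -
    have "x k \<noteq> x j" using assms(3)[OF that] by simp
    then show ?thesis
      unfolding u using assms(1) that by (simp add: prod.remove[of "I - {k}" j])
  qed
  ultimately show "poly (pderiv (pderiv y)) (x k) =
      2 * poly (pderiv y) (x k) * (\<Sum>i\<in>I - {k}. 1 / (x k - x i))"
    by (simp add: y' sum_distrib_left mult.assoc)
  show "poly (pderiv y) (x k) \<noteq> 0"
    unfolding y' u using assms(1,3) by fastforce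
qed

text \<open>
  Clearing denominators gives \<open>D Q\<^sup>2 = A (P' Q - P Q')\<close>, so \<open>Q\<close> divides \<open>P A Q'\<close>.  At a zero
  \<open>z\<close> of \<open>Q\<close> where \<open>A \<noteq> 0\<close>, coprimality gives \<open>P \<noteq> 0\<close>, so the order of \<open>P A Q'\<close> at
  \<open>z\<close> is that of \<open>Q'\<close>, which is one less than that of \<open>Q\<close>: a contradiction.
\<close>

lemma poles_subset_zeros_of_multiplier:
  fixes A D P Q :: "complex poly"
  assumes "Q \<noteq> 0" and "coprime P Q"
    and D: "\<And>x. poly Q x \<noteq> 0 \<Longrightarrow> poly D x = poly A x * deriv (\<lambda>x. poly P x / poly Q x) x"
    and z: "poly A z \<noteq> 0"
  shows "poly Q z \<noteq> 0"
proof
  assume Qz: "poly Q z = 0"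
  have "D * Q\<^sup>2 = A * (pderiv P * Q - P * pderiv Q)"
  proof (rule poly_eq_off_zeros[OF \<open>Q \<noteq> 0\<close>])
    fix x assume x: "poly Q x \<noteq> 0"
    have "((\<lambda>x. poly P x / poly Q x) has_field_derivative
        (poly (pderiv P) x * poly Q x - poly P x * poly (pderiv Q) x) / (poly Q x * poly Q x)) (at x)"
      by (intro DERIV_divide poly_DERIV x)
    then have "deriv (\<lambda>x. poly P x / poly Q x) x =
        (poly (pderiv P) x * poly Q x - poly P x * poly (pderiv Q) x) / (poly Q x * poly Q x)"
      by (rule DERIV_imp_deriv)
    with x D[OF x] show "poly (D * Q\<^sup>2) x = poly (A * (pderiv P * Q - P * pderiv Q)) x"
      by (simp add: power2_eq_square)
  qed
  then have "P * (A * pderiv Q) = Q * (A * pderiv P - D * Q)"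
    by (simp add: algebra_simps power2_eq_square)
  then have dvd: "Q dvd P * (A * pderiv Q)"
    by simp
  have Pz: "poly P z \<noteq> 0"
    using \<open>coprime P Q\<close> Qz coprime_common_divisor[of P Q "[:- z, 1:]"]
    by (auto simp: poly_eq_0_iff_dvd is_unit_pCons_iff)
  have "pderiv Q \<noteq> 0"
    using \<open>Q \<noteq> 0\<close> Qz by (metis degree_eq_zeroE mult_zero_right add_0_right pCons_0_0 pderiv_eq_0_iff poly_0 poly_pCons)
  then have nz: "P * (A * pderiv Q) \<noteq> 0" "A * pderiv Q \<noteq> 0"
    using z Pz by auto
  have "order z Q \<le> order z (P * (A * pderiv Q))"
    using dvd_imp_order_le[OF nz(1) dvd] .
  also have "\<dots> = order z (pderiv Q)"
    using order_mult[OF nz(1), of z] order_mult[OF nz(2), of z] z Pz by (simp add: order_0I)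
  also have "\<dots> < order z Q"
    using order_pderiv[OF \<open>Q \<noteq> 0\<close> Qz] by simp
  finally show False by simp
qed

section \<open>Degree bounds\<close>

text \<open>
  Because negative bounds admit only the zero polynomial, each of these rules holds for every
  integer bound.  In particular \<open>d - 1\<close> is correct for derivatives of constants, which spares the
  degree count any case distinction on small numbers of charges.
\<close>

lemma degree_at_most_add: "degree_at_most f d \<Longrightarrow> degree_at_most g d \<Longrightarrow> degree_at_most (f + g) d"
  unfolding degree_at_most_def by (smt (verit) add_0 add_0_right degree_add_le_max max_def of_nat_le_iff)

lemma degree_at_most_sum:
  "(\<And>i. i \<in> I \<Longrightarrow> degree_at_most (f i) d) \<Longrightarrow> degree_at_most (sum f I) d"
proof (induction I rule: infinite_finite_induct)
  case (insert i I)
  then show ?case by (simp add: degree_at_most_add)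
qed (simp_all add: degree_at_most_def)

lemma degree_at_most_smult: "degree_at_most f d \<Longrightarrow> degree_at_most (smult c f) d"
  by (auto simp: degree_at_most_def)

lemma degree_at_most_mult:
  "degree_at_most f d \<Longrightarrow> degree_at_most g e \<Longrightarrow> degree_at_most (f * g) (d + e)"
  by (cases "f = 0 \<or> g = 0") (auto simp: degree_at_most_def degree_mult_eq)

lemma degree_at_most_pderiv: "degree_at_most f d \<Longrightarrow> degree_at_most (pderiv f) (d - 1)"
  by (cases "degree f = 0") (auto simp: degree_at_most_def degree_pderiv pderiv_eq_0_iff)

lemma degree_at_most_mono: "degree_at_most f d \<Longrightarrow> d \<le> e \<Longrightarrow> degree_at_most f e"
  by (auto simp: degree_at_most_def)

lemma degree_at_most_prod_linear:
  "degree_at_most (\<Prod>i\<in>I. [:- x i, 1:]) (int (card I))"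
  by (simp add: degree_at_most_def degree_prod_eq_sum_degree)

lemma degree_at_most_factor:
  assumes "degree_at_most (f * g) (d + int (degree f))" and "f \<noteq> 0"
  shows "degree_at_most g d"
  using assms by (cases "g = 0") (auto simp: degree_at_most_def degree_mult_eq)

text \<open>
  Off the zeros of \<open>A\<close>, and hence everywhere, \<open>B\<close> agrees with
  \<open>\<Sum>\<^sub>j \<nu>\<^sub>j A / (x - a\<^sub>j)\<close>, whose summands are scalar multiples of products of
  \<open>m - 1\<close> linear factors.
\<close>

lemma degree_at_most_partial_fraction_numerator:
  assumes A: "A = (\<Prod>j<m. [:- a j, 1:])"
    and B: "\<And>x. poly A x \<noteq> 0 \<Longrightarrow> poly B x / poly A x = (\<Sum>j<m. \<nu> j / (x - a j))"
  shows "degree_at_most B (int m - 1)"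
proof -
  let ?A = "\<lambda>j. \<Prod>i\<in>{..<m} - {j}. [:- a i, 1:]"
  have "A \<noteq> 0" by (simp add: A)
  then have "B = (\<Sum>j<m. smult (\<nu> j) (?A j))"
  proof (rule poly_eq_off_zeros)
    fix x assume x: "poly A x \<noteq> 0"
    have "poly A x * (\<nu> j / (x - a j)) = \<nu> j * poly (?A j) x" if "j < m" for j
    proof -
      have eq: "A = [:- a j, 1:] * ?A j"
        unfolding A using that by (intro prod.remove) auto
      have "poly A x = poly [:- a j, 1:] x * poly (?A j) x"
        unfolding poly_mult[symmetric] by (rule arg_cong[OF eq])
      then have "poly A x = (x - a j) * poly (?A j) x"
        by simp
      with x show ?thesis by simp
    qed
    then have "poly A x * (\<Sum>j<m. \<nu> j / (x - a j)) = poly (\<Sum>j<m. smult (\<nu> j) (?A j)) x"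
      by (simp add: sum_distrib_left poly_sum)
    with B[OF x] x show "poly B x = poly (\<Sum>j<m. smult (\<nu> j) (?A j)) x"
      by (simp add: field_simps)
  qed
  moreover have "degree_at_most (?A j) (int m - 1)" if "j < m" for j
    using degree_at_most_prod_linear[of a "{..<m} - {j}"] that by (simp add: of_nat_diff)
  ultimately show ?thesis
    by (auto intro: degree_at_most_sum degree_at_most_smult)
qed

section \<open>Equilibrium as a Lame equation\<close>

text \<open>
  Here \<open>d\<close> stands for the value of \<open>r'\<close> at the charge.  The difference of the two sides of the
  equilibrium condition, multiplied by \<open>A y' \<noteq> 0\<close>, is the value of the differential expression.
\<close>

lemma lame_residual_at_charge:
  fixes X :: "complex ^ 'n::finite"
  assumes X: "X \<notin> arrangement m a"
    and A: "A = (\<Prod>j<m. [:- a j, 1:])"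
    and B: "\<And>x. poly A x \<noteq> 0 \<Longrightarrow> poly B x / poly A x = (\<Sum>j<m. \<nu> j / (x - a j))"
    and D: "poly D (X $ k) = poly A (X $ k) * d"
  defines "y \<equiv> \<Prod>k\<in>UNIV. [:- (X $ k), 1:]"
  shows "poly (A * pderiv (pderiv y) + (smult 2 B - smult \<rho> D) * pderiv y) (X $ k) = 0
      \<longleftrightarrow> 2 * charge_field m a \<nu> X k = \<rho> * d"
proof -
  have Ak: "poly A (X $ k) \<noteq> 0"
    using X by (simp add: not_in_arrangement_iff A poly_prod)
  have Bk: "poly B (X $ k) = poly A (X $ k) * (\<Sum>j<m. \<nu> j / (X $ k - a j))"
    using B[OF Ak] Ak by (metis nonzero_mult_div_cancel_left times_divide_eq_right)
  have ne: "X $ i \<noteq> X $ k" if "i \<in> UNIV - {k}" for i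
    using X that by (metis DiffD2 ComplI not_in_arrangement_iff)
  note y' = pderiv_prod_linear_at_root[of UNIV k "\<lambda>i. X $ i", OF finite UNIV_I ne, folded y_def]
  define E where "E = poly (pderiv y) (X $ k)"
  define F where "F = (\<Sum>j<m. \<nu> j / (X $ k - a j))"
  define G where "G = (\<Sum>i\<in>UNIV - {k}. 1 / (X $ k - X $ i))"
  have field: "charge_field m a \<nu> X k = F + G"
    by (simp add: charge_field_def F_def G_def Compl_eq_Diff_UNIV)
  have y'': "poly (pderiv (pderiv y)) (X $ k) = 2 * E * G"
    using y'(2) by (simp only: E_def G_def)
  have "poly (A * pderiv (pderiv y) + (smult 2 B - smult \<rho> D) * pderiv y) (X $ k)
      = poly A (X $ k) * E * (2 * charge_field m a \<nu> X k - \<rho> * d)"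
    by (simp add: y'' field Bk[folded F_def] D E_def[symmetric] algebra_simps)
  moreover have "poly A (X $ k) * E \<noteq> 0"
    using Ak y'(1) by (simp add: E_def)
  ultimately show ?thesis
    by (simp only: mult_eq_0_iff right_minus_eq simp_thms)
qed

theorem theorem1:
  fixes m :: nat and a \<nu> :: "nat \<Rightarrow> complex" and p q :: int
    and A B D P Q :: "complex poly" and r :: "complex \<Rightarrow> complex"
    and L R :: "complex ^ 'n::{finite,linorder} \<Rightarrow> complex"
    and \<Omega> \<A> :: "(complex ^ 'n::{finite,linorder}) set"
  assumes "inj_on a {..<m}"
    and "p = int m - 1"
    and "A = (\<Prod>j<m. [:- a j, 1:])"
    and "\<forall>x. poly A x \<noteq> 0 \<longrightarrow> poly B x / poly A x = (\<Sum>j<m. \<nu> j / (x - a j))"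
    and "Q \<noteq> 0" and "coprime P Q"
    and "r = (\<lambda>x. poly P x / poly Q x)"
    and "\<forall>x. poly Q x \<noteq> 0 \<longrightarrow> poly D x = poly A x * deriv r x"
    and "q = int (degree D)"
    and "R = (\<lambda>X. \<Sum>k\<in>UNIV. r (X $ k))"
    and "\<Omega> = {X. R X = 0}"
    and "L = energy m a \<nu>"
    and "\<A> = arrangement m a"
  shows
    "(\<forall>X. X \<in> \<Omega> - \<A> \<and> constrained_critical_point L R X \<longrightarrow>
        (\<exists>V \<rho>. degree_at_most V (max (p - 1) (q - 1)) \<and>
                lame_solution A B D V \<rho> (\<Prod>k\<in>UNIV. [:- (X $ k), 1:])))
     \<and>
     (\<forall>V \<rho> X. degree_at_most V (max (p - 1) (q - 1)) \<and>
        lame_solution A B D V \<rho> (\<Prod>k\<in>UNIV. [:- (X $ k), 1:]) \<and> X \<in> \<Omega> - \<A> \<longrightarrow>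
        (\<forall>k. complex_partial L k X + \<rho> / 4 * deriv r (X $ k) = 0))"
proof -
  have A: "A = (\<Prod>j<m. [:- a j, 1:])" and B: "\<And>x. poly A x \<noteq> 0 \<Longrightarrow> poly B x / poly A x = (\<Sum>j<m. \<nu> j / (x - a j))"
    and D: "\<And>x. poly Q x \<noteq> 0 \<Longrightarrow> poly D x = poly A x * deriv r x"
    and R: "R = (\<lambda>X. \<Sum>k\<in>UNIV. r (X $ k))" and L: "L = energy m a \<nu>"
    using assms by blast+
  let ?S = "{x. poly Q x \<noteq> 0}"
  let ?y = "\<lambda>X :: complex ^ ('n::{finite,linorder}). \<Prod>k\<in>UNIV. [:- (X $ k), 1:]"
  let ?N = "\<lambda>\<rho> y. A * pderiv (pderiv y) + (smult 2 B - smult \<rho> D) * pderiv y"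
  have "open ?S"
    by (intro open_Collect_neq continuous_intros)
  have "r holomorphic_on ?S"
    unfolding assms(7) by (intro holomorphic_intros) auto
  have regular: "X $ k \<in> ?S" if "X \<in> \<Omega> - \<A>" for X :: "complex ^ ('n::{finite,linorder})" and k
  proof -
    have "poly A (X $ k) \<noteq> 0"
      using that by (simp add: assms(13) not_in_arrangement_iff A poly_prod)
    then show ?thesis
      using poles_subset_zeros_of_multiplier[OF assms(5,6) D[unfolded assms(7)]] by simp
  qed
  have residual: "poly (?N \<rho> (?y X)) (X $ k) = 0 \<longleftrightarrow> 2 * charge_field m a \<nu> X k = \<rho> * deriv r (X $ k)"
    if "X \<in> \<Omega> - \<A>" for X :: "complex ^ ('n::{finite,linorder})" and k \<rho>
    using that regular[OF that] by (intro lame_residual_at_charge A B D) (auto simp: assms(13))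
  have "\<exists>V \<rho>. degree_at_most V (max (p - 1) (q - 1)) \<and> lame_solution A B D V \<rho> (?y X)"
    if X: "X \<in> \<Omega> - \<A>" and crit: "constrained_critical_point L R X" for X
  proof -
    let ?d = "max (p - 1) (q - 1)" and ?n = "int CARD('n)"
    obtain c where c: "\<And>k. charge_field m a \<nu> X k = c * deriv r (X $ k)"
      using lagrange_multiplier[OF \<open>open ?S\<close> \<open>r holomorphic_on ?S\<close> regular[OF X]] X crit
      unfolding L R assms(13) by blast
    have "inj (\<lambda>k. X $ k)"
      using X by (auto simp: assms(13) not_in_arrangement_iff inj_def)
    moreover have "poly (?N (2 * c) (?y X)) (X $ k) = 0" for k
      using residual[OF X] by (simp add: c)
    ultimately have "?y X dvd ?N (2 * c) (?y X)"
      by (intro prod_linear_dvd) auto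
    then obtain W where W: "?N (2 * c) (?y X) = ?y X * W" ..
    have y: "degree_at_most (?y X) ?n"
      using degree_at_most_prod_linear[of "\<lambda>k. X $ k" UNIV] by simp
    \<comment> \<open>With \<open>n\<close> movable charges, \<open>A y''\<close> has degree at most \<open>(p + 1) + (n - 2)\<close>.\<close>
    have "degree_at_most A (p + 1)"
      using degree_at_most_prod_linear[of a "{..<m}"] by (simp add: A assms(2))
    from degree_at_most_mult[OF this degree_at_most_pderiv[OF degree_at_most_pderiv[OF y]]]
    have 1: "degree_at_most (A * pderiv (pderiv (?y X))) (?d + ?n)"
      by (rule degree_at_most_mono) simp
    \<comment> \<open>The coefficient of \<open>y'\<close> has degree at most \<open>max p q\<close>, and \<open>y'\<close> at most \<open>n - 1\<close>.\<close>
    have "degree_at_most B p"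
      using degree_at_most_partial_fraction_numerator[OF A B] by (simp add: assms(2))
    then have "degree_at_most (smult 2 B) (?d + 1)"
      by (intro degree_at_most_smult) (erule degree_at_most_mono, simp add: max_def)
    moreover have "degree_at_most D (?d + 1)"
      by (simp add: degree_at_most_def assms(9) max_def)
    ultimately have "degree_at_most (smult 2 B + smult (- (2 * c)) D) (?d + 1)"
      by (rule degree_at_most_add[OF _ degree_at_most_smult])
    from degree_at_most_mult[OF this degree_at_most_pderiv[OF y]]
    have 2: "degree_at_most ((smult 2 B - smult (2 * c) D) * pderiv (?y X)) (?d + ?n)"
      by (simp add: add.assoc)
    have deg: "degree (?y X) = CARD('n)"
      by (simp add: degree_prod_eq_sum_degree)
    have "degree_at_most (?y X * W) (?d + int (degree (?y X)))"
      using degree_at_most_add[OF 1 2] unfolding W deg .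
    moreover have "?y X \<noteq> 0"
      by simp
    ultimately have "degree_at_most W ?d"
      by (rule degree_at_most_factor)
    \<comment> \<open>The field is \<open>c r'\<close>, so \<open>\<rho> = 2 c\<close>; the equation asks for \<open>N + V y = 0\<close>, so
      \<open>V\<close> is minus the quotient.\<close>
    then have "degree_at_most (- W) ?d"
      by (simp add: degree_at_most_def)
    moreover have "lame_solution A B D (- W) (2 * c) (?y X)"
      unfolding lame_solution_def W by (simp add: mult.commute)
    ultimately show ?thesis by blast
  qed
  moreover have "complex_partial L k X + \<rho> / 4 * deriv r (X $ k) = 0"
    if sol: "lame_solution A B D V \<rho> (?y X)" and X: "X \<in> \<Omega> - \<A>" for V \<rho> X k
  proof -
    have "poly (?y X) (X $ k) = 0"
      by (auto simp: poly_prod)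
    moreover have "poly (?N \<rho> (?y X)) (X $ k) + poly V (X $ k) * poly (?y X) (X $ k) = 0"
      using arg_cong[OF sol[unfolded lame_solution_def], of "\<lambda>f. poly f (X $ k)"]
      by (simp only: poly_add poly_mult poly_0)
    ultimately have "poly (?N \<rho> (?y X)) (X $ k) = 0"
      by (simp only: mult_zero_right add_0_right)
    then have "2 * charge_field m a \<nu> X k = \<rho> * deriv r (X $ k)"
      using residual[OF X] by blast
    moreover have "complex_partial L k X = - (2 * charge_field m a \<nu> X k) / 4"
      using X by (simp add: L complex_partial_energy assms(13))
    ultimately show ?thesis
      by simp
  qed
  ultimately show ?thesis by blast
qed

end
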